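(* Let $n\ge 2$, let $k\ge 1$, and let $i=(i_1,\dots,i_k)$ be a $k$-tuple of integers with $i_p\ge 2$ for $p=1,\dots,k$. Then $$\mathrm{I}(A_n,i)\le 1-k+\sum_{p=1}^{k} i_p ,$$ that is, $M_{i_1}(A_n)\cdots M_{i_k}(A_n)\not\subset M_{i_1+\cdots+i_k-k+2}(A_n)$.
   Context: $\mathcal{K}$ is a field of characteristic zero, and $A_n$ is the free associative unitary $\mathcal{K}$-algebra on generators $x_1,\dots,x_n$. For an associative unitary $\mathcal{K}$-algebra $R$ put $[a,b]=ab-ba$. Define $L_1(R)=R$ and, for $i\ge 2$, $L_i(R)=[R,L_{i-1}(R)]$ (the linear span of all $[a,l]$ with $a\in R$, $l\in L_{i-1}(R)$). Let $M_i(R)=R\cdot L_i(R)\cdot R$ be the two-sided ideal of $R$ generated by $L_i(R)$; then $M_1(R)\supset M_2(R)\supset\cdots$. Products of ideals are the usual ones (linear spans of products of elements). For a $k$-tuple $i=(i_1,\dots,i_k)$ with all $i_p\ge 2$, $\mathrm{I}(R,i)$ denotes the maximal index $m\in\mathbb{N}$ such that $M_{i_1}(R)\cdots M_{i_k}(R)\subset M_m(R)$, i.e. the product is contained in $M_{m}(R)$ but not in $M_{m+1}(R)$. *)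

theory Defs
  imports Complex_Main "HOL-Library.Poly_Mapping"
begin

section \<open>Lower central series ideals of an associative algebra\<close>

locale assoc_algebra = vector_space scale
  for scale :: "'k::field \<Rightarrow> 'a::ring_1 \<Rightarrow> 'a" +
  assumes scale_mult_left: "scale c a * b = scale c (a * b)"
    and scale_mult_right: "a * scale c b = scale c (a * b)"
begin

definition commutator :: "'a \<Rightarrow> 'a \<Rightarrow> 'a" where
  "commutator a b = a * b - b * a"

text \<open>Indexing starts at 1; the value at 0 is a dummy.\<close>

fun L :: "nat \<Rightarrow> 'a set" where
  "L 0 = UNIV"
| "L (Suc 0) = UNIV"
| "L (Suc (Suc i)) = span {commutator a l | a l. l \<in> L (Suc i)}"

definition M :: "nat \<Rightarrow> 'a set" where
  "M i = span {a * l * b | a l b. l \<in> L i}"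

text \<open>The product of a nonempty list of ideals. (For the empty list one gets the scalars, which
  plays no role.)\<close>

definition ideal_prod :: "'a set list \<Rightarrow> 'a set" where
  "ideal_prod Is = span {prod_list xs | xs. list_all2 (\<in>) xs Is}"

text \<open>The value is unspecified if the product lies in \<^term>\<open>M m\<close> for arbitrarily large \<^term>\<open>m\<close>;
  an upper bound on it is informative only together with a non-containment.\<close>

definition max_index :: "nat list \<Rightarrow> nat" where
  "max_index is = (GREATEST m. 1 \<le> m \<and> ideal_prod (map M is) \<subseteq> M m)"

end


section \<open>The free associative algebra\<close>

text \<open>The free monoid on \<^typ>\<open>'x\<close>, written additively because multiplication of
  \<^type>\<open>poly_mapping\<close> is convolution over a \<^class>\<open>monoid_add\<close>; \<open>+\<close> is concatenation and is not
  commutative.\<close>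

datatype 'x free_monoid = Word (letters: "'x list")

instantiation free_monoid :: (type) monoid_add
begin

definition "0 = Word []"

definition "u + v = Word (letters u @ letters v)"

instance
  by standard (simp_all add: zero_free_monoid_def plus_free_monoid_def)

end

text \<open>The monoid algebra of the free monoid: noncommutative polynomials in the variables
  \<^typ>\<open>'x\<close> with coefficients in \<^typ>\<open>'k\<close>. With \<open>CARD('x) = n\<close> this is the free associative
  unital algebra on \<open>n\<close> generators \<open>Poly_Mapping.single (Word [x]) 1\<close>.\<close>

type_synonym ('x, 'k) free_alg = "'x free_monoid \<Rightarrow>\<^sub>0 'k"

definition free_alg_scale :: "'k::field \<Rightarrow> ('x, 'k) free_alg \<Rightarrow> ('x, 'k) free_alg" where
  "free_alg_scale c p = Poly_Mapping.map ((*) c) p"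

lemma lookup_free_alg_scale:
  "Poly_Mapping.lookup (free_alg_scale c p) w = c * Poly_Mapping.lookup p w"
  by (simp add: free_alg_scale_def Poly_Mapping.map.rep_eq when_def)

lemma free_alg_scale_eq_mult:
  "free_alg_scale c p = Poly_Mapping.single 0 c * p"
  unfolding free_alg_scale_def by (rule mult_map_scale_conv_mult)

lemma single_zero_commutes:
  fixes p :: "('x, 'k::field) free_alg"
  shows "p * Poly_Mapping.single 0 c = Poly_Mapping.single 0 c * p"
proof (induction p rule: update_induct)
  case const
  show ?case by simp
next
  case (update f a b)
  have "Poly_Mapping.update a b f = f + Poly_Mapping.single a b"
    using update(1)
    by (intro poly_mapping_eqI)
      (auto simp: lookup_update lookup_add lookup_single in_keys_iff when_def)
  with update show ?case
    by (simp add: distrib_left distrib_right mult_single mult.commute)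
qed

global_interpretation free_alg: assoc_algebra
  "free_alg_scale :: 'k::field \<Rightarrow> ('x, 'k) free_alg \<Rightarrow> ('x, 'k) free_alg"
proof
  fix a b :: 'k and p q :: "('x, 'k) free_alg"
  show "free_alg_scale a (p + q) = free_alg_scale a p + free_alg_scale a q"
    by (simp add: free_alg_scale_eq_mult distrib_left)
  show "free_alg_scale (a + b) p = free_alg_scale a p + free_alg_scale b p"
    by (simp add: free_alg_scale_eq_mult single_add distrib_right)
  show "free_alg_scale a (free_alg_scale b p) = free_alg_scale (a * b) p"
    by (simp add: free_alg_scale_eq_mult mult.assoc[symmetric] mult_single)
  show "free_alg_scale 1 p = p"
    by (simp add: free_alg_scale_eq_mult)
  show "free_alg_scale a p * q = free_alg_scale a (p * q)"
    by (simp add: free_alg_scale_eq_mult mult.assoc)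
  show "p * free_alg_scale a q = free_alg_scale a (p * q)"
    by (metis free_alg_scale_eq_mult mult.assoc single_zero_commutes)
qed

end

theory Submission
  imports Defs "HOL-Computational_Algebra.Polynomial"
begin

text \<open>Let \<open>R\<close> be the skew polynomial ring over \<open>k[h][u]\<close> in \<open>y\<close> with \<open>y u = (u - h) y\<close>. It is
  commutative modulo the central element \<open>h\<close>, so every algebra map into \<open>R\<close> sends \<open>M\<^sub>m\<close>
  into \<open>h\<^sup>m\<^sup>-\<^sup>1 R\<close>. Send one generator to \<open>y\<close> and all others to \<open>u\<close>. Since \<open>[u, y] = h y\<close>, the
  \<open>(i - 1)\<close>-fold commutator of \<open>u\<close> with \<open>y\<close> is \<open>h\<^sup>i\<^sup>-\<^sup>1 y\<close>, and the product of these elements over all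
  \<open>i\<^sub>p\<close> is \<open>h\<^sup>S y\<^sup>k\<close> with \<open>S = \<Sum>(i\<^sub>p - 1)\<close>. It is not divisible by \<open>h\<^sup>S\<^sup>+\<^sup>1\<close>.\<close>

section \<open>The coefficient ring k[h][u] and its shifts\<close>

definition hbar :: "'k::comm_ring_1 poly poly" where
  "hbar = [:[:0, 1:]:]"

text \<open>Conjugation by y^a in R: moving y^a to the right past f(u) turns it into f(u - a h). The
  outer polynomial variable is u, the inner one is h.\<close>

definition shift :: "nat \<Rightarrow> 'k::comm_ring_1 poly poly \<Rightarrow> 'k poly poly" where
  "shift a f = pcompose f [:- (of_nat a * [:0, 1:]), 1:]"

lemma shift_0 [simp]: "shift 0 f = f"
  by (simp add: shift_def)

lemma shift_zero [simp]: "shift a 0 = 0"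
  by (simp add: shift_def)

lemma shift_one [simp]: "shift a 1 = 1"
  by (simp add: shift_def pcompose_1)

lemma shift_add: "shift a (f + g) = shift a f + shift a g"
  by (simp add: shift_def pcompose_add)

lemma shift_mult: "shift a (f * g) = shift a f * shift a g"
  by (simp add: shift_def pcompose_mult)

lemma shift_const [simp]: "shift a [:c:] = [:c:]"
  by (simp add: shift_def)

lemma shift_shift: "shift a (shift b f) = shift (a + b) f"
  by (simp add: shift_def pcompose_assoc[symmetric] pcompose_pCons algebra_simps)

lemma hbar_power: "hbar ^ d = [:[:0, 1:] ^ d:]"
  by (induction d) (simp_all add: hbar_def)

lemma shift_hbar_power [simp]: "shift a (hbar ^ d) = hbar ^ d"
  by (simp add: hbar_power)

text \<open>At h = 0 the substitution becomes the identity; this makes R commutative modulo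
  h.\<close>

lemma hbar_dvd_shift_diff: "hbar dvd shift a f - f"
proof (induction f)
  case 0
  show ?case by simp
next
  case (pCons c f)
  have "shift a (pCons c f) - pCons c f
      = [:0, 1:] * (shift a f - f) - hbar * (of_nat a * shift a f)"
    by (simp add: shift_def pcompose_pCons hbar_def of_nat_poly algebra_simps
        flip: smult_add_left)
  with pCons show ?case
    by (simp only: dvd_diff dvd_mult dvd_triv_left)
qed

lemma hbar_power_dvd_iff:
  "(hbar :: 'k::field poly poly) ^ m dvd hbar ^ n \<longleftrightarrow> m \<le> n"
proof -
  have "hbar \<noteq> (0 :: 'k poly poly)" "\<not> is_unit (hbar :: 'k poly poly)"
    by (auto simp: hbar_def is_unit_const_poly_iff is_unit_poly_iff)
  then show ?thesis
    by (simp add: dvd_power_iff)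
qed

section \<open>The map into the skew polynomial ring\<close>

text \<open>\<open>word_coeff y ls\<close> is the coefficient of the power of \<open>y\<close> in the image of the word \<open>ls\<close>
  in \<open>R\<close>, all powers of \<open>y\<close> being moved to the right.\<close>

fun word_coeff :: "'x \<Rightarrow> 'x list \<Rightarrow> 'k::comm_ring_1 poly poly" where
  "word_coeff y [] = 1"
| "word_coeff y (l # ls) = (if l = y then shift 1 (word_coeff y ls) else [:0, 1:] * word_coeff y ls)"

text \<open>Every y occurring in \<open>ls\<close> still has to pass the coefficient of
  \<open>ms\<close>, shifting it once.\<close>

lemma word_coeff_append:
  "word_coeff y (ls @ ms) = word_coeff y ls * shift (count_list ls y) (word_coeff y ms)"
  by (induction ls) (simp_all add: shift_mult shift_shift mult.assoc)

text \<open>The coefficient of y^j in the image of \<open>p\<close>. The ring R is not constructed;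
  its elements appear only through these coefficients.\<close>

definition symbol :: "'x \<Rightarrow> ('x, 'k::field) free_alg \<Rightarrow> nat \<Rightarrow> 'k poly poly" where
  "symbol y p j = (\<Sum>w\<in>Poly_Mapping.keys p. if count_list (letters w) y = j
     then [:[:Poly_Mapping.lookup p w:]:] * word_coeff y (letters w) else 0)"

lemma symbol_superset:
  assumes "finite W" "Poly_Mapping.keys p \<subseteq> W"
  shows "symbol y p j = (\<Sum>w\<in>W. if count_list (letters w) y = j
     then [:[:Poly_Mapping.lookup p w:]:] * word_coeff y (letters w) else 0)"
  unfolding symbol_def using assms
  by (intro sum.mono_neutral_left) (auto simp: in_keys_iff)

lemma symbol_zero [simp]: "symbol y 0 j = 0"
  by (simp add: symbol_def)

lemma symbol_single:
  "symbol y (Poly_Mapping.single w c) j =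
    (if count_list (letters w) y = j then [:[:c:]:] * word_coeff y (letters w) else 0)"
  by (subst symbol_superset[of "{w}"]) auto

lemma symbol_add: "symbol y (p + q) j = symbol y p j + symbol y q j"
proof -
  let ?W = "Poly_Mapping.keys p \<union> Poly_Mapping.keys q"
  have "Poly_Mapping.keys (p + q) \<subseteq> ?W"
    by (rule Poly_Mapping.keys_add)
  then show ?thesis
    by (simp add: symbol_superset[of ?W] sum.distrib[symmetric] lookup_add)
       (auto intro!: sum.cong simp: lookup_add simp flip: smult_add_left)
qed

lemma symbol_diff: "symbol y (p - q) j = symbol y p j - symbol y q j"
  using symbol_add[of y "p - q" q j] by simp

lemma free_alg_induct [case_names single add]:
  fixes p :: "('x, 'k::field) free_alg"
  assumes single: "\<And>w c. P (Poly_Mapping.single w c)"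
    and add: "\<And>p q. P p \<Longrightarrow> P q \<Longrightarrow> P (p + q)"
  shows "P p"
proof (induction p rule: update_induct)
  case const
  show ?case using single[of _ 0] by simp
next
  case (update f a b)
  have "Poly_Mapping.update a b f = f + Poly_Mapping.single a b"
    using update(1)
    by (intro poly_mapping_eqI)
      (auto simp: lookup_update lookup_add lookup_single in_keys_iff when_def)
  with update show ?case
    by (simp add: add single)
qed

text \<open>This is multiplication in R, where f y^a times g y^b is f (shift a g) y^(a+b). Both
  sides are biadditive, so monomials suffice, and there it is
  \<open>word_coeff_append\<close>.\<close>

lemma symbol_mult:
  "symbol y (p * q) j = (\<Sum>a\<le>j. symbol y p a * shift a (symbol y q (j - a)))"
proof (induction p rule: free_alg_induct)
  case (single v c)
  show ?case
  proof (induction q rule: free_alg_induct)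
    case (single w d)
    let ?n = "count_list (letters v) y"
    have "(\<Sum>a\<le>j. symbol y (Poly_Mapping.single v c) a *
        shift a (symbol y (Poly_Mapping.single w d) (j - a))) =
      (\<Sum>a\<le>j. if a = ?n then [:[:c:]:] * word_coeff y (letters v) *
        shift a (symbol y (Poly_Mapping.single w d) (j - a)) else 0)"
      by (intro sum.cong) (auto simp: symbol_single)
    also have "\<dots> = (if ?n \<le> j then [:[:c:]:] * word_coeff y (letters v) *
        shift ?n (symbol y (Poly_Mapping.single w d) (j - ?n)) else 0)"
      by simp
    also have "\<dots> = symbol y (Poly_Mapping.single v c * Poly_Mapping.single w d) j"
    proof -
      have "[:[:c * d:]:] = [:[:c:]:] * [:[:d:]:]"
        by simp
      then show ?thesis
        by (auto simp: mult_single symbol_single plus_free_monoid_def word_coeff_append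
            shift_mult mult_ac simp del: mult_pCons_left mult_pCons_right)
    qed
    finally show ?case ..
  next
    case (add q r)
    then show ?case
      by (simp add: distrib_left symbol_add shift_add sum.distrib)
  qed
next
  case (add p r)
  then show ?case
    by (simp add: distrib_right symbol_add sum.distrib)
qed

lemma symbol_scale: "symbol y (free_alg_scale c p) j = [:[:c:]:] * symbol y p j"
proof -
  have "symbol y (free_alg_scale c p) j =
      (\<Sum>a\<le>j. if a = 0 then [:[:c:]:] * symbol y p j else 0)"
    unfolding free_alg_scale_eq_mult symbol_mult
    by (intro sum.cong) (auto simp: symbol_single zero_free_monoid_def)
  then show ?thesis
    by simp
qed

section \<open>The filtration by powers of h\<close>

text \<open>The preimage of h^d R; the order meant is that of vanishing at h = 0.\<close>

definition order_filtration :: "'x \<Rightarrow> nat \<Rightarrow> ('x, 'k::field) free_alg set" where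
  "order_filtration y d = {p. \<forall>j. hbar ^ d dvd symbol y p j}"

lemma order_filtration_0 [simp]: "order_filtration y 0 = UNIV"
  by (simp add: order_filtration_def)

lemma subspace_order_filtration: "free_alg.subspace (order_filtration y d)"
  by (intro free_alg.subspaceI)
     (auto simp: order_filtration_def symbol_add symbol_scale simp del: mult_pCons_left)

lemma hbar_power_dvd_shift:
  assumes "hbar ^ d dvd f"
  shows "hbar ^ d dvd shift a f"
  using assms by (auto simp: shift_mult)

lemma order_filtration_mult_left:
  assumes "q \<in> order_filtration y d"
  shows "p * q \<in> order_filtration y d"
  using assms by (auto simp: order_filtration_def symbol_mult
      intro!: dvd_sum dvd_mult hbar_power_dvd_shift)

lemma order_filtration_mult_right:
  assumes "q \<in> order_filtration y d"
  shows "q * p \<in> order_filtration y d"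
  using assms by (auto simp: order_filtration_def symbol_mult intro!: dvd_sum dvd_mult2)

lemma hbar_power_Suc_dvd_shift_diff:
  assumes "hbar ^ d dvd f"
  shows "hbar ^ Suc d dvd shift a f - f"
proof -
  obtain g where "f = hbar ^ d * g"
    using assms by (rule dvdE)
  then have "shift a f - f = hbar ^ d * (shift a g - g)"
    by (simp add: shift_mult algebra_simps)
  then show ?thesis
    unfolding power_Suc2 by (simp add: hbar_dvd_shift_diff mult_dvd_mono)
qed

text \<open>As k[h][u] is commutative, the two products differ only through shifts, and each shift
  difference brings an extra factor h.\<close>

lemma commutator_in_order_filtration:
  assumes "q \<in> order_filtration y d"
  shows "free_alg.commutator p q \<in> order_filtration y (Suc d)"
  unfolding order_filtration_def mem_Collect_eq
proof
  fix j
  let ?P = "symbol y p" and ?Q = "symbol y q"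
  have Q: "hbar ^ d dvd ?Q b" for b
    using assms by (simp add: order_filtration_def)
  \<comment> \<open>Reversing the index pairs \<open>?P a\<close> with \<open>?Q (j - a)\<close> in
    both products, so that the unshifted terms cancel below.\<close>
  have "(\<Sum>a\<le>j. ?Q a * shift a (?P (j - a))) = (\<Sum>a\<le>j. ?Q (j - a) * shift (j - a) (?P a))"
    by (rule sum.reindex_bij_witness[of _ "\<lambda>a. j - a" "\<lambda>a. j - a"]) auto
  then have "symbol y (free_alg.commutator p q) j =
      (\<Sum>a\<le>j. ?P a * (shift a (?Q (j - a)) - ?Q (j - a))
            - ?Q (j - a) * (shift (j - a) (?P a) - ?P a))"
    by (simp add: free_alg.commutator_def symbol_diff symbol_mult sum_subtractf[symmetric]
        algebra_simps)
  also have "hbar ^ Suc d dvd \<dots>"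
  proof (intro dvd_sum dvd_diff)
    fix a
    show "hbar ^ Suc d dvd ?P a * (shift a (?Q (j - a)) - ?Q (j - a))"
      by (intro dvd_mult hbar_power_Suc_dvd_shift_diff Q)
    show "hbar ^ Suc d dvd ?Q (j - a) * (shift (j - a) (?P a) - ?P a)"
      unfolding power_Suc2 by (intro mult_dvd_mono Q hbar_dvd_shift_diff)
  qed
  finally show "hbar ^ Suc d dvd symbol y (free_alg.commutator p q) j" .
qed

text \<open>Each bracket gains one h; \<open>L\<close> is indexed from 1, so
  \<open>L (Suc i)\<close> involves \<open>i\<close> brackets.\<close>

lemma L_subset_order_filtration: "(free_alg.L (Suc i) :: ('x, 'k::field) free_alg set) \<subseteq> order_filtration y i"
proof (induction i)
  case 0
  show ?case by simp
next
  case (Suc i)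
  then have "{free_alg.commutator a l | a l. l \<in> (free_alg.L (Suc i) :: ('x, 'k) free_alg set)}
      \<subseteq> order_filtration y (Suc i)"
    by (blast intro: commutator_in_order_filtration)
  then show ?case
    by (simp add: free_alg.span_minimal subspace_order_filtration)
qed

text \<open>The filtration pieces are two-sided ideals, so generating an ideal from
  \<open>L (Suc i)\<close> stays inside.\<close>

lemma M_subset_order_filtration: "free_alg.M (Suc i) \<subseteq> order_filtration y i"
  unfolding free_alg.M_def
  using L_subset_order_filtration[of i y]
  by (intro free_alg.span_minimal subspace_order_filtration)
     (blast intro: order_filtration_mult_left order_filtration_mult_right)

section \<open>Iterated commutators as witnesses\<close>

fun iterated_commutator :: "'x \<Rightarrow> 'x \<Rightarrow> nat \<Rightarrow> ('x, 'k::field) free_alg" where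
  "iterated_commutator x y 0 = Poly_Mapping.single (Word [y]) 1"
| "iterated_commutator x y (Suc n) =
    free_alg.commutator (Poly_Mapping.single (Word [x]) 1) (iterated_commutator x y n)"

lemma iterated_commutator_in_L: "iterated_commutator x y n \<in> free_alg.L (Suc n)"
  by (induction n) (auto intro: free_alg.span_base)

lemma L_subset_M: "(free_alg.L i :: ('x, 'k::field) free_alg set) \<subseteq> free_alg.M i"
proof
  fix l :: "('x, 'k) free_alg"
  assume "l \<in> free_alg.L i"
  then have "1 * l * 1 \<in> free_alg.M i"
    unfolding free_alg.M_def by (blast intro: free_alg.span_base)
  then show "l \<in> free_alg.M i"
    by simp
qed

text \<open>In R, [u, h^n y] = h^n (u - (u - h)) y = h^(n+1) y.\<close>

lemma symbol_iterated_commutator: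
  assumes "x \<noteq> y"
  shows "symbol y (iterated_commutator x y n :: ('x, 'k::field) free_alg) j =
    (if j = 1 then hbar ^ n else 0)"
proof (induction n arbitrary: j)
  case 0
  show ?case
    by (simp add: symbol_single flip: one_pCons)
next
  case (Suc n)
  let ?X = "Poly_Mapping.single (Word [x]) 1 :: ('x, 'k) free_alg"
  let ?q = "iterated_commutator x y n :: ('x, 'k) free_alg"
  have X: "symbol y ?X a = (if a = 0 then [:0, 1:] else 0)" for a
    using assms by (simp add: symbol_single)
  \<comment> \<open>The image of \<open>?X\<close> is u, of degree 0 in y, and that of
    \<open>?q\<close> has degree 1, so one summand survives in each product.\<close>
  have "symbol y (?X * ?q) j =
      (\<Sum>a\<le>j. if a = 0 then [:0, 1:] * (if j = 1 then hbar ^ n else 0) else 0)"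
    unfolding symbol_mult X Suc by (intro sum.cong) auto
  moreover have "symbol y (?q * ?X) j =
      (\<Sum>a\<le>j. if a = 1 then hbar ^ n * shift 1 (if j = 1 then [:0, 1:] else 0) else 0)"
    unfolding symbol_mult X Suc by (intro sum.cong) auto
  moreover have "shift 1 [:0, 1:] = [:0, 1:] - (hbar :: 'k poly poly)"
    by (simp add: shift_def hbar_def pcompose_pCons)
  ultimately show ?case
    by (simp add: free_alg.commutator_def symbol_diff right_diff_distrib mult.commute)
qed

text \<open>Powers of h are central, so the exponents of h and of y simply add up.\<close>

lemma symbol_prod_list_iterated_commutator:
  assumes "x \<noteq> y"
  shows "symbol y (prod_list (map (\<lambda>m. iterated_commutator x y (m - 1)) i) :: ('x, 'k::field) free_alg) j =
    (if j = length i then hbar ^ (\<Sum>m\<leftarrow>i. m - 1) else 0)"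
proof (induction i arbitrary: j)
  case Nil
  have "symbol y (Poly_Mapping.single 0 1 :: ('x, 'k) free_alg) j = (if j = 0 then 1 else 0)"
    by (simp add: symbol_single zero_free_monoid_def flip: one_pCons)
  then show ?case
    by simp
next
  case (Cons m i)
  have "symbol y (prod_list (map (\<lambda>m. iterated_commutator x y (m - 1)) (m # i))
      :: ('x, 'k) free_alg) j =
      (\<Sum>a\<le>j. if a = 1 then (if j = Suc (length i) then
        hbar ^ (m - 1) * hbar ^ (\<Sum>m\<leftarrow>i. m - 1) else 0) else 0)"
    unfolding list.map prod_list.Cons symbol_mult symbol_iterated_commutator[OF assms] Cons
    by (intro sum.cong) auto
  then show ?case
    by (auto simp: power_add)
qed

section \<open>The bound on the index\<close>

text \<open>For positive \<open>m\<close>, the product of the witnesses lies in \<open>M m\<close>,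
  so h^(m-1) divides its image; but its only nonzero coefficient is a pure power of h.\<close>

lemma index_le_if_ideal_prod_subset_M:
  fixes x y :: 'x
  assumes "x \<noteq> y" and ge: "\<forall>m\<in>set i. 1 \<le> m"
    and sub: "(free_alg.ideal_prod (map free_alg.M i) :: ('x, 'k::field) free_alg set) \<subseteq> free_alg.M m"
  shows "m \<le> Suc (\<Sum>m\<leftarrow>i. m - 1)"
proof (cases m)
  case (Suc d)
  let ?zs = "map (\<lambda>m. iterated_commutator x y (m - 1)) i :: ('x, 'k) free_alg list"
  have "(iterated_commutator x y (m - 1) :: ('x, 'k) free_alg) \<in> free_alg.M m" if "m \<in> set i" for m
  proof -
    have "Suc (m - 1) = m"
      using ge that by force
    then show ?thesis
      using subsetD[OF L_subset_M iterated_commutator_in_L] by metis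
  qed
  then have "list_all2 (\<in>) ?zs (map free_alg.M i)"
    by (auto simp: list_all2_conv_all_nth)
  then have "prod_list ?zs \<in> free_alg.ideal_prod (map free_alg.M i)"
    unfolding free_alg.ideal_prod_def by (blast intro: free_alg.span_base)
  then have "prod_list ?zs \<in> order_filtration y d"
    using subsetD[OF sub] unfolding Suc by (blast intro: subsetD[OF M_subset_order_filtration])
  then have "hbar ^ d dvd symbol y (prod_list ?zs) (length i)"
    by (simp add: order_filtration_def)
  then have "hbar ^ d dvd (hbar :: 'k poly poly) ^ (\<Sum>m\<leftarrow>i. m - 1)"
    by (simp only: symbol_prod_list_iterated_commutator[OF \<open>x \<noteq> y\<close>] if_True refl)
  then show ?thesis
    using Suc by (simp add: hbar_power_dvd_iff)
qed simp

lemma M_one: "free_alg.M 1 = UNIV"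
  using L_subset_M[of "Suc 0"] by auto

theorem proposition2p2:
  fixes i :: "nat list"
  assumes "card (UNIV :: 'x::finite set) \<ge> 2"
    and "length i \<ge> 1"
    and "\<forall>p < length i. i ! p \<ge> 2"
  shows "int (assoc_algebra.max_index
            (free_alg_scale :: 'k::field_char_0 \<Rightarrow> ('x, 'k) free_alg \<Rightarrow> ('x, 'k) free_alg) i)
          \<le> 1 - int (length i) + (\<Sum>p<length i. int (i ! p))
    \<and> \<not> (free_alg.ideal_prod (map free_alg.M i) :: ('x, 'k) free_alg set)
          \<subseteq> free_alg.M ((\<Sum>p<length i. i ! p) + 2 - length i)"
proof -
  obtain x y :: 'x where "x \<noteq> y"
    using assms(1) by (metis (full_types) card_le_Suc0_iff_eq finite not_less_eq_eq numeral_2_eq_2)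
  have ge: "\<forall>m\<in>set i. 1 \<le> m"
    using assms(3) by (force simp: in_set_conv_nth)
  let ?S = "\<Sum>m\<leftarrow>i. m - 1"
  let ?P = "\<lambda>m. 1 \<le> m \<and>
    (free_alg.ideal_prod (map free_alg.M i) :: ('x, 'k) free_alg set) \<subseteq> free_alg.M m"
  have bound: "m \<le> Suc ?S" if "?P m" for m
    using index_le_if_ideal_prod_subset_M[OF \<open>x \<noteq> y\<close> ge] that by blast
  \<comment> \<open>The index 1 qualifies and \<open>bound\<close> limits all others, so
    \<open>GREATEST\<close> is attained and not an unspecified value.\<close>
  have "?P 1"
    by (simp add: M_one[simplified])
  then have "?P (GREATEST m. ?P m)"
    using bound by (rule GreatestI_nat)
  then have max: "assoc_algebra.max_index
      (free_alg_scale :: 'k \<Rightarrow> ('x, 'k) free_alg \<Rightarrow> ('x, 'k) free_alg) i \<le> Suc ?S"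
    unfolding free_alg.max_index_def by (rule bound)
  have "sum_list i = ?S + length i"
    using ge by (induction i) auto
  then have sum: "(\<Sum>p<length i. i ! p) = ?S + length i"
    by (simp add: sum_list_sum_nth atLeast0LessThan)
  then have "(\<Sum>p<length i. int (i ! p)) = int ?S + int (length i)"
    by (metis of_nat_add of_nat_sum)
  \<comment> \<open>Since the entries sum to \<open>?S + length i\<close>, the index
    \<open>?S + 2\<close> is the one in the non-containment, just above the bound.\<close>
  moreover have "\<not> ?P (?S + 2)"
    using bound[of "?S + 2"] by auto
  ultimately show ?thesis
    using max sum by simp
qed

end
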